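(* Let $p>3$ be a prime. Then $$\sum_{k=1}^{p-1}\frac{(-1)^k}k\binom{-1/4}k\equiv 3q_p(2)-\frac{3}2pq_p(2)^2-\Big(2-\Big(\frac{-1}p\Big)\Big)pE_{p-3}\pmod{p^2}.$$
   Context: For $x,y\in\mathbb Q$ with denominators prime to $p$, $x\equiv y\pmod{p^m}$ means $(x-y)/p^m$ has denominator prime to $p$. For rational $a$ and integer $k\ge0$, $\binom ak=a(a-1)\cdots(a-k+1)/k!$. $q_p(2)=(2^{p-1}-1)/p$ is the Fermat quotient, $\big(\frac{-1}p\big)$ the Legendre symbol. The Euler numbers are defined by $E_0=1$, $E_n=-\sum_{k=1}^{[n/2]}\binom n{2k}E_{n-2k}$ for $n\ge1$. *)

theory Defs
  imports "HOL-Number_Theory.Number_Theory"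
begin

definition denom_coprime :: "nat \<Rightarrow> rat \<Rightarrow> bool" where
  "denom_coprime p x \<longleftrightarrow> coprime (snd (quotient_of x)) (int p)"

text \<open>The relation is only meant for rationals with denominators prime to \<open>p\<close>;
  this is made part of it, so it never holds for other arguments.\<close>

definition rat_cong :: "nat \<Rightarrow> nat \<Rightarrow> rat \<Rightarrow> rat \<Rightarrow> bool" where
  "rat_cong p m x y \<longleftrightarrow>
     denom_coprime p x \<and> denom_coprime p y \<and> denom_coprime p ((x - y) / of_nat p ^ m)"

definition fermat_quotient :: "nat \<Rightarrow> nat \<Rightarrow> rat" where
  "fermat_quotient p a = (of_nat a ^ (p - 1) - 1) / of_nat p"

text \<open>The signed Euler numbers, with value 0 at odd indices: 1, 0, -1, 0, 5, 0, -61, ...\<close>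

fun euler_number :: "nat \<Rightarrow> int" where
  "euler_number 0 = 1"
| "euler_number (Suc n) =
     - (\<Sum>k = 1..Suc n div 2. int (Suc n choose (2 * k)) * euler_number (Suc n - 2 * k))"

end

theory Submission
  imports Defs
begin

text \<open>
  Let \<open>F a\<close> be the sum with \<open>- 1 / 4\<close> replaced by \<open>a\<close>. By Pascal's rule,
  \<open>F a - F (a - 1) = ((a - 1 gchoose (p - 1)) - 1) / a\<close>, and for \<open>p\<close>-integral \<open>t\<close> one has
  \<open>F (p t) \<equiv> 0\<close> modulo \<open>p\<^sup>2\<close>; summing up,
  \<open>F (p t + r) \<equiv> - H1 r + 2 p t H2 r\<close> for \<open>r < p\<close>, where \<open>H1\<close>, \<open>H2\<close> are the harmonic sums
  of first and second order. With \<open>q = p div 4\<close>, the choices \<open>t = - 1 / 4\<close>, \<open>r = q\<close> and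
  \<open>t = - 3 / 4\<close>, \<open>r = p - 1 - q\<close> for \<open>p \<equiv> 1\<close> and \<open>p \<equiv> 3\<close> modulo 4 give
  \<open>F (- 1 / 4) \<equiv> - H1 q - \<chi> p / 2 H2 q\<close>, where \<open>\<chi> = (- 1) ^ ((p - 1) / 2)\<close>.

  Euler polynomials evaluate the alternating sums of \<open>(2 k) ^ n\<close>. For \<open>n = p - 3\<close> this yields
  \<open>H2 q \<equiv> 4 \<chi> E\<close> modulo \<open>p\<close> with \<open>E\<close> the Euler number of index \<open>p - 3\<close>, and for
  \<open>n = p (p - 1) - 1\<close> it yields \<open>H1 q \<equiv> 3 / 2 H1 ((p - 1) / 2) - \<chi> p E\<close> modulo \<open>p\<^sup>2\<close>.
  Finally, with \<open>m = (p - 1) / 2\<close>, expanding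
  \<open>\<Prod>k\<le>m. (1 - p / k) = 2 ^ (p - 1) * \<Prod>k\<le>m. (1 - p / (2 k))\<close> modulo \<open>p ^ 3\<close>
  expresses \<open>H1 m\<close> through the Fermat quotient.
\<close>

section \<open>Euler numbers, Euler polynomials and alternating power sums\<close>

lemma euler_number_odd: "odd n \<Longrightarrow> euler_number n = 0"
proof (induction n rule: less_induct)
  case (less n)
  then obtain n' where n: "n = Suc n'" by (cases n) auto
  have "int (n choose (2 * k)) * euler_number (n - 2 * k) = 0" if "k \<in> {1..n div 2}" for k
    using less.IH[of "n - 2 * k"] less.prems that by auto
  hence "(\<Sum>k = 1..n div 2. int (n choose (2 * k)) * euler_number (n - 2 * k)) = 0"
    by (rule sum.neutral[OF ballI])
  thus ?case unfolding n euler_number.simps(2) by linarith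
qed

text \<open>This is the umbral identity \<open>(E + 1)^n + (E - 1)^n = 0\<close> for
  \<open>n > 0\<close>. The factor kills the indices with \<open>n - k\<close> odd and doubles the
  others; substituting \<open>n - 2 * k\<close> for \<open>k\<close> leaves twice the defining
  recurrence, with its left-hand side as the term of index 0.\<close>

lemma euler_number_sum:
  "(\<Sum>k\<le>n. int (n choose k) * euler_number k * (1 + (-1) ^ (n - k))) = (if n = 0 then 2 else 0)"
proof (cases n)
  case (Suc n')
  let ?h = "\<lambda>k. int (n choose (2 * k)) * euler_number (n - 2 * k)"
  have "(\<Sum>k\<le>n. int (n choose k) * euler_number k * (1 + (-1) ^ (n - k)))
      = (\<Sum>k\<in>{k. k \<le> n \<and> even (n - k)}. int (n choose k) * euler_number k * 2)"
    by (intro sum.mono_neutral_cong_right) auto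
  also have "\<dots> = (\<Sum>k\<in>{0..n div 2}. ?h k * 2)"
    by (rule sum.reindex_bij_witness[of _ "\<lambda>k. n - 2 * k" "\<lambda>k. (n - k) div 2"])
      (auto simp: binomial_symmetric[symmetric] intro!: arg_cong2[of _ _ _ _ "(*)"] elim!: evenE)
  also have "\<dots> = (?h 0 + (\<Sum>k\<in>{1..n div 2}. ?h k)) * 2"
    by (subst sum.atLeast_Suc_atMost) (simp_all add: sum_distrib_right distrib_right)
  also have "\<dots> = 0"
    unfolding Suc by (simp del: euler_number.simps add: euler_number.simps(2))
  finally show ?thesis using Suc by simp
qed simp

text \<open>This is \<open>2 ^ n\<close> times the Euler polynomial of degree \<open>n\<close> at \<open>(x + 1) / 2\<close>.\<close>

definition euler_sum :: "nat \<Rightarrow> int \<Rightarrow> int" where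
  "euler_sum n x = (\<Sum>k\<le>n. int (n choose k) * euler_number k * x ^ (n - k))"

text \<open>The difference equation of the Euler polynomials. After binomial expansion and a swap of
  the sums, the coefficient of \<open>x ^ (n - j)\<close> is \<open>n choose j\<close> times the sum
  in \<open>euler_number_sum\<close> for \<open>j\<close>, so only \<open>j = 0\<close>
  survives.\<close>

lemma euler_sum_step: "euler_sum n (x + 1) + euler_sum n (x - 1) = 2 * x ^ n"
proof -
  let ?E = euler_number
  \<comment> \<open>The inner sum is padded with zeros to the range \<open>j \<le> n\<close>,
    independent of \<open>k\<close>, so that the two sums can be swapped.\<close>
  have *: "(x + 1) ^ (n - k) + (x - 1) ^ (n - k)
     = (\<Sum>j\<le>n. if k \<le> j then int ((n - k) choose (j - k)) * x ^ (n - j) * (1 + (-1) ^ (j - k)) else 0)"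
    if "k \<le> n" for k
  proof -
    have "(x + 1) ^ (n - k) + (x - 1) ^ (n - k)
      = (\<Sum>i\<le>n - k. int ((n - k) choose i) * x ^ (n - k - i) * (1 + (-1) ^ i))"
      using binomial_ring[of 1 x "n - k"] binomial_ring[of "-1" x "n - k"]
      by (simp add: algebra_simps sum.distrib)
    also have "\<dots> = (\<Sum>j\<in>{k..n}. int ((n - k) choose (j - k)) * x ^ (n - j) * (1 + (-1) ^ (j - k)))"
      by (rule sum.reindex_bij_witness[of _ "\<lambda>j. j - k" "\<lambda>i. i + k"])
        (use that in \<open>auto simp: diff_diff_left add.commute\<close>)
    also have "\<dots> = (\<Sum>j\<le>n. if k \<le> j then int ((n - k) choose (j - k)) * x ^ (n - j) * (1 + (-1) ^ (j - k)) else 0)"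
      by (intro sum.mono_neutral_cong_left) auto
    finally show ?thesis .
  qed
  have "euler_sum n (x + 1) + euler_sum n (x - 1)
     = (\<Sum>k\<le>n. int (n choose k) * ?E k * ((x + 1) ^ (n - k) + (x - 1) ^ (n - k)))"
    unfolding euler_sum_def by (simp add: sum.distrib distrib_left)
  also have "\<dots> = (\<Sum>k\<le>n. \<Sum>j\<le>n. if k \<le> j then int (n choose k) * int ((n - k) choose (j - k)) * ?E k * (1 + (-1) ^ (j - k)) * x ^ (n - j) else 0)"
    by (intro sum.cong refl) (simp add: * sum_distrib_left mult_ac if_distrib cong: if_cong)
  also have "\<dots> = (\<Sum>j\<le>n. \<Sum>k\<le>n. if k \<le> j then int (n choose k) * int ((n - k) choose (j - k)) * ?E k * (1 + (-1) ^ (j - k)) * x ^ (n - j) else 0)"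
    by (rule sum.swap)
  also have "\<dots> = (\<Sum>j\<le>n. int (n choose j) * x ^ (n - j) * (if j = 0 then 2 else 0))"
  proof (intro sum.cong refl)
    fix j assume j: "j \<in> {..n}"
    have "(\<Sum>k\<le>n. if k \<le> j then int (n choose k) * int ((n - k) choose (j - k)) * ?E k * (1 + (-1) ^ (j - k)) * x ^ (n - j) else 0)
       = (\<Sum>k\<le>j. int (n choose j) * int (j choose k) * ?E k * (1 + (-1) ^ (j - k)) * x ^ (n - j))"
      using j choose_mult[of _ j n]
      by (intro sum.mono_neutral_cong_right) (auto simp flip: of_nat_mult)
    also have "\<dots> = int (n choose j) * x ^ (n - j) * (\<Sum>k\<le>j. int (j choose k) * ?E k * (1 + (-1) ^ (j - k)))"
      by (simp add: sum_distrib_left mult_ac)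
    finally show "(\<Sum>k\<le>n. if k \<le> j then int (n choose k) * int ((n - k) choose (j - k)) * ?E k * (1 + (-1) ^ (j - k)) * x ^ (n - j) else 0)
       = int (n choose j) * x ^ (n - j) * (if j = 0 then 2 else 0)"
      unfolding euler_number_sum .
  qed
  also have "\<dots> = 2 * x ^ n"
    by (subst sum.remove[of _ 0]) auto
  finally show ?thesis .
qed

text \<open>Apply \<open>euler_sum_step\<close> at the even points 2, 4, ..., 2M with alternating
  signs.\<close>

lemma euler_sum_telescope:
  "euler_sum n 1 - (-1) ^ M * euler_sum n (2 * int M + 1)
     = - 2 * (\<Sum>k = 1..M. (-1) ^ k * (2 * int k) ^ n)"
proof (induction M)
  case (Suc M)
  have "euler_sum n (2 * int (Suc M) + 1) + euler_sum n (2 * int M + 1) = 2 * (2 * int (Suc M)) ^ n"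
    using euler_sum_step[of n "2 * int (Suc M)"] by (simp add: algebra_simps)
  hence *: "euler_sum n (2 * int (Suc M) + 1) = 2 * (2 * int (Suc M)) ^ n - euler_sum n (2 * int M + 1)"
    by linarith
  show ?case unfolding * using Suc.IH by (simp add: algebra_simps del: of_nat_Suc)
qed simp

text \<open>Since \<open>n\<close> is even, the factor \<open>1 + (-1) ^ (n - k)\<close> is 2 for
  even \<open>k\<close>, while for odd \<open>k\<close> the Euler number vanishes; so twice the
  value is the sum in \<open>euler_number_sum\<close>.\<close>

lemma euler_sum_1: "even n \<Longrightarrow> n > 0 \<Longrightarrow> euler_sum n 1 = 0"
proof -
  assume n: "even n" "n > 0"
  have "2 * euler_sum n 1 = (\<Sum>k\<le>n. int (n choose k) * euler_number k * (1 + (-1) ^ (n - k)))"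
    unfolding euler_sum_def sum_distrib_left
    by (intro sum.cong refl) (use n euler_number_odd in \<open>auto simp: minus_one_power_iff\<close>)
  thus ?thesis using n euler_number_sum[of n] by simp
qed

lemma power_taylor: "\<exists>c. (x + h) ^ n = x ^ n + of_nat n * x ^ (n - 1) * h + h\<^sup>2 * (c :: 'a :: comm_ring_1)"
proof (induction n)
  case (Suc n)
  then obtain c where c: "(x + h) ^ n = x ^ n + of_nat n * x ^ (n - 1) * h + h\<^sup>2 * c" by blast
  show ?case
    unfolding power_Suc c
    by (rule exI[of _ "of_nat n * x ^ (n - 1) + c * (x + h)"], cases n)
      (simp_all add: algebra_simps power2_eq_square)
qed (auto intro!: exI[of _ 0])

text \<open>Taylor expansion to first order: the derivative of \<open>euler_sum (Suc n)\<close> is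
  \<open>Suc n\<close> times \<open>euler_sum n\<close>.\<close>

lemma euler_sum_taylor:
  "h\<^sup>2 dvd euler_sum (Suc n) (x + h) - (euler_sum (Suc n) x + h * (int (Suc n) * euler_sum n x))"
proof -
  have "euler_sum (Suc n) (x + h) - (euler_sum (Suc n) x + h * (int (Suc n) * euler_sum n x)) =
    (\<Sum>k\<le>Suc n. int (Suc n choose k) * euler_number k *
       ((x + h) ^ (Suc n - k) - (x ^ (Suc n - k) + of_nat (Suc n - k) * x ^ (Suc n - k - 1) * h)))"
  proof -
    have "(\<Sum>k\<le>Suc n. int (Suc n choose k) * euler_number k * (of_nat (Suc n - k) * x ^ (Suc n - k - 1)))
        = (\<Sum>k\<le>n. int (Suc n choose k) * euler_number k * (of_nat (Suc n - k) * x ^ (n - k)))"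
      by simp
    also have "\<dots> = (\<Sum>k\<le>n. int (Suc n) * (int (n choose k) * euler_number k * x ^ (n - k)))"
    proof (intro sum.cong refl)
      fix k assume "k \<in> {..n}"
      have "(Suc n choose k) * (Suc n - k) = Suc n * (n choose k)"
        using binomial_absorb_comp[of "Suc n" k] by (simp add: mult_ac)
      hence "int (Suc n choose k) * int (Suc n - k) = int (Suc n) * int (n choose k)"
        by (simp only: flip: of_nat_mult)
      hence "(int (Suc n choose k) * int (Suc n - k)) * (euler_number k * x ^ (n - k)) =
         int (Suc n) * int (n choose k) * (euler_number k * x ^ (n - k))" by (rule arg_cong)
      thus "int (Suc n choose k) * euler_number k * (int (Suc n - k) * x ^ (n - k)) =
         int (Suc n) * (int (n choose k) * euler_number k * x ^ (n - k))" by (simp only: mult_ac)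
    qed
    also have "\<dots> = int (Suc n) * euler_sum n x"
      unfolding euler_sum_def sum_distrib_left ..
    finally show ?thesis
      unfolding euler_sum_def[of "Suc n"]
      by (simp only: right_diff_distrib distrib_left sum_subtractf sum.distrib mult.assoc
          flip: sum_distrib_left sum_distrib_right mult.assoc) (simp add: mult_ac)
  qed
  also have "h\<^sup>2 dvd \<dots>"
  proof (intro dvd_sum dvd_mult)
    fix k
    obtain c where "(x + h) ^ (Suc n - k) = x ^ (Suc n - k) + of_nat (Suc n - k) * x ^ (Suc n - k - 1) * h + h\<^sup>2 * c"
      using power_taylor by blast
    thus "h\<^sup>2 dvd (x + h) ^ (Suc n - k) - (x ^ (Suc n - k) + of_nat (Suc n - k) * x ^ (Suc n - k - 1) * h)"
      by simp
  qed
  finally show ?thesis .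
qed

lemma euler_sum_0: "euler_sum n 0 = euler_number n"
  unfolding euler_sum_def by (subst sum.remove[of _ n]) (auto intro!: sum.neutral)

section \<open>Splitting sums and products by reflection and by parity\<close>

context comm_monoid_set
begin

lemma split_reflect:
  fixes h :: "nat \<Rightarrow> 'a"
  shows "F h {1..n + r} = F h {1..n} \<^bold>* F (\<lambda>k. h (n + r + 1 - k)) {1..r}"
proof -
  have "F (\<lambda>k. h (n + r + 1 - k)) {1..r} = F h {n + 1..n + r}"
    by (rule reindex_bij_witness[of _ "\<lambda>k. n + r + 1 - k" "\<lambda>k. n + r + 1 - k"]) auto
  moreover have "{1..n} \<union> {n + 1..n + r} = {1..n + r}"
    by auto
  moreover have "F h ({1..n} \<union> {n + 1..n + r}) = F h {1..n} \<^bold>* F h {n + 1..n + r}"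
    by (rule union_disjoint) auto
  ultimately show ?thesis by (simp only:)
qed

text \<open>The odd indices are written as \<open>2 * n + 1 - 2 * k\<close> so that for
  \<open>2 * n + 1 = p\<close> they are the reflections \<open>p - 2 * k\<close> of the even ones.
  Working in \<open>comm_monoid_set\<close> serves sums and products alike.\<close>

lemma split_even_odd:
  fixes h :: "nat \<Rightarrow> 'a"
  shows "F h {1..2 * n} = F (\<lambda>k. h (2 * k)) {1..n} \<^bold>* F (\<lambda>k. h (2 * n + 1 - 2 * k)) {1..n}"
proof -
  have "F (\<lambda>k. h (2 * k)) {1..n} = F h {k \<in> {1..2 * n}. even k}"
    by (rule reindex_bij_witness[of _ "\<lambda>k. k div 2" "\<lambda>k. 2 * k"]) auto
  moreover have "F (\<lambda>k. h (2 * n + 1 - 2 * k)) {1..n} = F h {k \<in> {1..2 * n}. odd k}"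
    by (rule reindex_bij_witness[of _ "\<lambda>k. (2 * n + 1 - k) div 2" "\<lambda>k. 2 * n + 1 - 2 * k"])
      (auto elim!: oddE simp flip: right_diff_distrib')
  moreover have "{k \<in> {1..2 * n}. even k} \<union> {k \<in> {1..2 * n}. odd k} = {1..2 * n}"
    by auto
  moreover have "F h ({k \<in> {1..2 * n}. even k} \<union> {k \<in> {1..2 * n}. odd k})
      = F h {k \<in> {1..2 * n}. even k} \<^bold>* F h {k \<in> {1..2 * n}. odd k}"
    by (rule union_disjoint) auto
  ultimately show ?thesis by (simp only:)
qed

end

section \<open>Arithmetic of rationals with denominator prime to \<open>p\<close>\<close>

locale large_prime =
  fixes p :: nat
  assumes prime: "prime p" and gt3: "p > 3"
begin

text \<open>\<open>J m\<close> is the ideal generated by \<open>p ^ m\<close> in the ring \<open>J 0\<close> of rationals with denominator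
  prime to \<open>p\<close>.\<close>

definition J :: "nat \<Rightarrow> rat \<Rightarrow> bool" where
  "J m x \<longleftrightarrow> (\<exists>a b. \<not> int p dvd b \<and> x = of_nat p ^ m * of_int a / of_int b)"

lemma prime_int: "prime (int p)"
  using prime by simp

lemma J_I: "\<not> int p dvd b \<Longrightarrow> x = of_nat p ^ m * of_int a / of_int b \<Longrightarrow> J m x"
  unfolding J_def by blast

lemma J_E:
  assumes "J m x"
  obtains a b where "\<not> int p dvd b" "b \<noteq> 0" "x = of_nat p ^ m * of_int a / of_int b"
  using assms unfolding J_def by (metis dvd_0_right)

lemma not_dvd_mult: "\<not> int p dvd b \<Longrightarrow> \<not> int p dvd c \<Longrightarrow> \<not> int p dvd b * c"
  using prime_dvd_mult_iff[OF prime_int] by blast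

lemma J_of_int [simp, intro]: "J 0 (of_int a)"
  by (rule J_I[of 1 _ _ a]) (use gt3 in auto)

lemma J_of_nat [simp, intro]: "J 0 (of_nat a)"
  using J_of_int[of "int a"] by simp

lemma J_numeral [simp, intro]: "J 0 (numeral a)"
  using J_of_int[of "numeral a"] by simp

lemma J_zero [simp, intro]: "J m 0"
  by (rule J_I[of 1 _ _ 0]) (use gt3 in auto)

lemma J_one [simp, intro]: "J 0 1"
  using J_of_int[of 1] by simp

lemma J_p_power [simp, intro]: "J m (of_nat p ^ m)"
  by (rule J_I[of 1 _ _ 1]) (use gt3 in auto)

lemma J_p [simp, intro]: "J (Suc 0) (of_nat p)"
  using J_p_power[of 1] by simp

lemma J_add [intro]:
  assumes "J m x" "J m y" shows "J m (x + y)"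
proof -
  from assms(1) obtain a b where 1: "\<not> int p dvd b" "b \<noteq> 0" "x = of_nat p ^ m * of_int a / of_int b"
    by (rule J_E)
  from assms(2) obtain c d where 2: "\<not> int p dvd d" "d \<noteq> 0" "y = of_nat p ^ m * of_int c / of_int d"
    by (rule J_E)
  show ?thesis
    by (rule J_I[of "b * d" _ _ "a * d + c * b"])
      (use 1 2 not_dvd_mult in \<open>auto simp: field_simps\<close>)
qed

lemma J_minus [intro]: "J m x \<Longrightarrow> J m (- x)"
  by (elim J_E, rule J_I[of _ _ _ "- _"]) auto

lemma J_diff [intro]: "J m x \<Longrightarrow> J m y \<Longrightarrow> J m (x - y)"
  using J_add[of m x "- y"] by auto

lemma J_mult:
  assumes "J m x" "J n y" shows "J (m + n) (x * y)"
proof -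
  from assms(1) obtain a b where 1: "\<not> int p dvd b" "b \<noteq> 0" "x = of_nat p ^ m * of_int a / of_int b"
    by (rule J_E)
  from assms(2) obtain c d where 2: "\<not> int p dvd d" "d \<noteq> 0" "y = of_nat p ^ n * of_int c / of_int d"
    by (rule J_E)
  show ?thesis
    by (rule J_I[of "b * d" _ _ "a * c"])
      (use 1 2 not_dvd_mult in \<open>auto simp: field_simps power_add\<close>)
qed

lemma J_mult_left [intro]: "J 0 x \<Longrightarrow> J n y \<Longrightarrow> J n (x * y)"
  using J_mult[of 0 x n y] by simp

lemma J_mult_right: "J m x \<Longrightarrow> J 0 y \<Longrightarrow> J m (x * y)"
  using J_mult[of m x 0 y] by simp

lemma J_mono: "J n x \<Longrightarrow> m \<le> n \<Longrightarrow> J m x"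
  by (elim J_E, rule J_I[of _ _ _ "int p ^ (n - m) * _"])
    (auto simp flip: power_add mult.assoc)

lemma J_0: "J n x \<Longrightarrow> J 0 x"
  using J_mono by blast

lemma J_sum [intro]: "(\<And>i. i \<in> A \<Longrightarrow> J m (f i)) \<Longrightarrow> J m (sum f A)"
  by (induction A rule: infinite_finite_induct) auto

lemma J_power [intro]: "J 0 x \<Longrightarrow> J 0 (x ^ n)"
  by (induction n) auto

text \<open>An element congruent modulo \<open>p\<close> to an integer prime to \<open>p\<close> is
  a unit of \<open>J 0\<close>: its numerator \<open>j * b + p * a\<close> is prime to
  \<open>p\<close>. This covers non-integral divisors such as \<open>p t + j\<close>.\<close>

lemma J_divide_unit:
  assumes "J 1 (u - of_int j)" "\<not> int p dvd j"
  shows "u \<noteq> 0" and "J m x \<Longrightarrow> J m (x / u)"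
proof -
  from assms(1) obtain a b where 1: "\<not> int p dvd b" "b \<noteq> 0" "u - of_int j = of_nat p ^ 1 * of_int a / of_int b"
    by (rule J_E)
  define c where "c = j * b + int p * a"
  have c: "\<not> int p dvd c"
    unfolding c_def using not_dvd_mult[OF assms(2) 1(1)] by (simp add: dvd_add_left_iff)
  hence c0: "c \<noteq> 0" by auto
  have u: "u = of_int c / of_int b"
    using 1 by (simp add: c_def field_simps)
  show "u \<noteq> 0" using u c0 1 by simp
  have "J 0 (1 / u)"
    by (rule J_I[OF c, of _ _ b]) (use u c0 1 in simp)
  thus "J m x \<Longrightarrow> J m (x / u)"
    using J_mult_right[of m x "1 / u"] by simp
qed

lemma J_divide_int: "\<not> int p dvd j \<Longrightarrow> J m x \<Longrightarrow> J m (x / of_int j)"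
  using J_divide_unit(2)[of "of_int j" j m x] by simp

lemma J_divide_nat [intro]: "0 < j \<Longrightarrow> j < p \<Longrightarrow> J m x \<Longrightarrow> J m (x / of_nat j)"
  using J_divide_int[of "int j" m x] by (auto dest: nat_dvd_not_less)

lemma p_not_dvd_2_pow: "\<not> int p dvd 2 ^ n"
  using prime_dvd_power_int[OF prime_int, of 2 n] gt3 zdvd_imp_le[of "int p" 2] by auto

lemma J_divide_2 [intro]: "J m x \<Longrightarrow> J m (x / 2)"
  using J_divide_int[of 2 m x] p_not_dvd_2_pow[of 1] by auto

lemma J_divide_4 [intro]: "J m x \<Longrightarrow> J m (x / 4)"
  using J_divide_int[of 4 m x] p_not_dvd_2_pow[of 2] by auto

lemma J_divide_8 [intro]: "J m x \<Longrightarrow> J m (x / 8)"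
  using J_divide_int[of 8 m x] p_not_dvd_2_pow[of 3] by auto

lemma J_divide_3 [intro]: "J m x \<Longrightarrow> J m (x / 3)"
  using J_divide_nat[of 3 m x] gt3 by auto

lemma J_p_mult: "J m x \<Longrightarrow> J (Suc m) (of_nat p * x)"
  using J_mult[OF J_p, of m x] by simp

lemma J_p_mult_iff: "J (Suc m) (of_nat p * x) \<longleftrightarrow> J m x"
proof
  assume "J (Suc m) (of_nat p * x)"
  then obtain a b where "\<not> int p dvd b" "b \<noteq> 0" "of_nat p * x = of_nat p ^ Suc m * of_int a / of_int b"
    by (rule J_E)
  thus "J m x" using gt3 by (intro J_I[of b _ _ a]) (auto simp: field_simps)
qed (rule J_p_mult)

text \<open>\<open>quotient_of\<close> yields the reduced fraction, whose denominator divides that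
  of any other representation; hence one denominator prime to \<open>p\<close> suffices.\<close>

lemma denom_coprime_iff: "denom_coprime p x \<longleftrightarrow> J 0 x"
proof -
  obtain a b where q: "quotient_of x = (a, b)" by fastforce
  have b: "b > 0" "coprime a b" "x = of_int a / of_int b"
    using q quotient_of_denom_pos quotient_of_coprime quotient_of_div by auto
  have 1: "denom_coprime p x \<longleftrightarrow> \<not> int p dvd b"
    unfolding denom_coprime_def q snd_conv
    using prime_int prime_imp_coprime_int[of "int p" b] coprime_absorb_left[of "int p" b]
    by (auto simp: coprime_commute[of b] not_prime_unit)
  show ?thesis
  proof
    assume "denom_coprime p x"
    thus "J 0 x" using 1 b by (intro J_I[of b _ _ a]) auto
  next
    assume "J 0 x"
    then obtain c d where d: "\<not> int p dvd d" "d \<noteq> 0" "x = of_nat p ^ 0 * of_int c / of_int d"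
      by (rule J_E)
    have "of_int (a * d) = (of_int (c * b) :: rat)"
      using b d by (auto simp: field_simps)
    hence "a * d = c * b" by (simp only: of_int_eq_iff)
    hence "b dvd d" using b(2) by (metis coprime_commute coprime_dvd_mult_right_iff dvd_triv_right)
    thus "denom_coprime p x" using 1 d(1) dvd_trans by blast
  qed
qed

lemma rat_cong_iff: "rat_cong p m x y \<longleftrightarrow> J 0 x \<and> J 0 y \<and> J m (x - y)"
proof -
  have "J 0 ((x - y) / of_nat p ^ m) \<longleftrightarrow> J m (x - y)"
    using gt3 unfolding J_def by (simp add: field_simps)
  thus ?thesis unfolding rat_cong_def denom_coprime_iff by simp
qed

text \<open>In contrast to \<open>rat_cong\<close>, only the difference is constrained; integrality
  of the two sides is settled separately where needed.\<close>

abbreviation eqv :: "nat \<Rightarrow> rat \<Rightarrow> rat \<Rightarrow> bool" where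
  "eqv m x y \<equiv> J m (x - y)"

lemma eqv_sym: "eqv m x y \<Longrightarrow> eqv m y x"
  using J_minus[of m "x - y"] by simp

lemma eqv_trans [trans]: "eqv m x y \<Longrightarrow> eqv m y z \<Longrightarrow> eqv m x z"
  using J_add[of m "x - y" "y - z"] by simp

lemma eqv_mult:
  assumes "eqv m x y" "eqv m u v" "J 0 x" "J 0 v"
  shows "eqv m (x * u) (y * v)"
proof -
  have "x * u - y * v = x * (u - v) + (x - y) * v" by (simp add: algebra_simps)
  thus ?thesis using J_mult_left[OF assms(3,2)] J_mult_right[OF assms(1,4)] by auto
qed

lemma eqv_sum:
  assumes "\<And>i. i \<in> A \<Longrightarrow> eqv m (f i) (g i)"
  shows "eqv m (sum f A) (sum g A)"
  using J_sum[of A m "\<lambda>i. f i - g i"] assms by (simp add: sum_subtractf)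

section \<open>Harmonic sums modulo \<open>p\<close> and \<open>p^2\<close>\<close>

abbreviation H1 :: "nat \<Rightarrow> rat" where "H1 n \<equiv> \<Sum>k = 1..n. 1 / of_nat k"
abbreviation H2 :: "nat \<Rightarrow> rat" where "H2 n \<equiv> \<Sum>k = 1..n. 1 / of_nat k ^ 2"
abbreviation half :: nat where "half \<equiv> (p - 1) div 2"
abbreviation chi :: rat where "chi \<equiv> (-1) ^ half"

lemma odd_p: "odd p"
  using prime gt3 prime_odd_nat by auto

lemma p_eq: "p = 2 * half + 1"
  using odd_p by (auto elim: oddE)

lemma half_props: "p - 1 - half = half" "half < p" "2 * int half + 1 = int p"
  using odd_p by (auto elim!: oddE)

lemma half_div_2: "half div 2 = p div 4"
  by (subst (2) p_eq) linarith

lemma chi_square: "chi * chi = 1"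
  by (simp flip: power_mult_distrib)

lemma J_chi [simp, intro]: "J 0 chi"
  by (intro J_power J_minus J_one)

lemma J_H1 [intro]: "n < p \<Longrightarrow> J 0 (H1 n)"
  by (intro J_sum J_divide_nat J_one) auto

lemma J_divide_nat_power: "0 < j \<Longrightarrow> j < p \<Longrightarrow> J m x \<Longrightarrow> J m (x / of_nat j ^ n)"
proof (induction n)
  case (Suc n)
  thus ?case using J_divide_nat[of j m "x / of_nat j ^ n"] by (simp add: mult.commute)
qed simp

text \<open>The geometric expansion of \<open>1 / (p - k)\<close> in powers of \<open>p / k\<close>,
  cut after two terms; the exact remainder is \<open>p^2 / ((p - k) k^2)\<close>.\<close>

lemma inverse_reflect:
  assumes "0 < k" "k < p"
  shows "eqv 2 (1 / of_nat (p - k)) (- (1 / of_nat k) - of_nat p / of_nat k ^ 2)"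
proof -
  have "1 / of_nat (p - k) - (- (1 / of_nat k) - of_nat p / of_nat k ^ 2)
     = (of_nat p ^ 2 / of_nat (p - k) / of_nat k ^ 2 :: rat)"
    using assms by (simp add: of_nat_diff divide_simps) (simp add: power2_eq_square algebra_simps)
  also have "J 2 \<dots>"
    using assms by (intro J_divide_nat_power J_divide_nat J_p_power) auto
  finally show ?thesis .
qed

lemma inverse_square_reflect:
  assumes "0 < k" "k < p"
  shows "eqv 1 (1 / of_nat (p - k) ^ 2) (1 / of_nat k ^ 2)"
proof -
  have "1 / of_nat (p - k) ^ 2 - 1 / of_nat k ^ 2
     = (of_nat p ^ 1 * (of_int (2 * int k - int p)) / of_nat (p - k) ^ 2 / of_nat k ^ 2 :: rat)"
    using assms by (simp add: of_nat_diff divide_simps) (simp add: power2_eq_square algebra_simps)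
  also have "J 1 \<dots>"
    using assms by (intro J_divide_nat_power J_mult_right[OF J_p_power] J_of_int) auto
  finally show ?thesis .
qed

lemma sum_reflect:
  fixes f :: "nat \<Rightarrow> rat"
  assumes "r < p"
  shows "sum f {1..p - 1} = sum f {1..p - 1 - r} + (\<Sum>k = 1..r. f (p - k))"
  using sum.split_reflect[of f "p - 1 - r" r] assms by simp

lemma H2_reflect:
  assumes "r < p"
  shows "eqv 1 (H2 (p - 1)) (H2 (p - 1 - r) + H2 r)"
proof -
  have "eqv 1 (\<Sum>k = 1..r. 1 / of_nat (p - k) ^ 2) (H2 r)"
    by (intro eqv_sum inverse_square_reflect) (use assms in auto)
  thus ?thesis unfolding sum_reflect[OF assms] by simp
qed

lemma H1_reflect:
  assumes "r < p"
  shows "eqv 2 (H1 (p - 1)) (H1 (p - 1 - r) - H1 r - of_nat p * H2 r)"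
proof -
  have "eqv 2 (\<Sum>k = 1..r. 1 / of_nat (p - k)) (\<Sum>k = 1..r. - (1 / of_nat k) - of_nat p / of_nat k ^ 2)"
    by (intro eqv_sum inverse_reflect) (use assms in auto)
  also have "(\<Sum>k = 1..r. - (1 / of_nat k) - of_nat p / of_nat k ^ 2) = - H1 r - of_nat p * H2 r"
    by (simp add: sum_subtractf sum_negf sum_distrib_left)
  finally show ?thesis unfolding sum_reflect[OF assms] by (simp add: algebra_simps)
qed

text \<open>Evaluate \<open>H2 (p - 1)\<close> modulo \<open>p\<close> twice. Reflection gives
  \<open>2 * H2 half\<close>; splitting by parity gives twice the even part, that is
  \<open>H2 half / 2\<close>. The difference is \<open>3 / 2 * H2 half\<close>, and 3 is invertible
  because \<open>p > 3\<close>.\<close>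

lemma H2_half: "J 1 (H2 half)"
proof -
  have "eqv 1 (\<Sum>k = 1..half. 1 / of_nat (p - 2 * k) ^ 2) (\<Sum>k = 1..half. 1 / of_nat (2 * k) ^ 2)"
    by (intro eqv_sum inverse_square_reflect) auto
  hence "eqv 1 (H2 (p - 1)) (2 * (\<Sum>k = 1..half. 1 / of_nat (2 * k) ^ 2))"
    using sum.split_even_odd[of "\<lambda>k. 1 / of_nat k ^ 2 :: rat" half] odd_p by simp
  also have "2 * (\<Sum>k = 1..half. 1 / of_nat (2 * k) ^ 2) = H2 half / 2"
    by (simp add: sum_distrib_left sum_divide_distrib power2_eq_square mult_ac)
  finally have 1: "eqv 1 (H2 (p - 1)) (H2 half / 2)" .
  have 2: "eqv 1 (H2 (p - 1)) (2 * H2 half)"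
    using H2_reflect[OF half_props(2)] unfolding half_props(1) by simp
  have "J 1 (2 * H2 half - H2 half / 2)"
    using J_diff[OF 1 2] by simp
  hence "J 1 (2 * (2 * H2 half - H2 half / 2) / 3)"
    by (intro J_divide_3 J_mult_left J_numeral)
  thus ?thesis by simp
qed

lemma H2_full: "J 1 (H2 (p - 1))"
proof -
  have "J 1 (H2 (p - 1) - (H2 half + H2 half) + (H2 half + H2 half))"
    using H2_reflect[OF half_props(2)] H2_half unfolding half_props(1) by (intro J_add)
  thus ?thesis by (simp only: diff_add_cancel)
qed

text \<open>Wolstenholme's congruence: reflecting the whole range gives \<open>H1 (p - 1)\<close>
  congruent to its own negative minus \<open>p * H2 (p - 1)\<close>, and the last term vanishes
  modulo \<open>p^2\<close>.\<close>

lemma H1_full: "J 2 (H1 (p - 1))"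
proof -
  have "eqv 2 (H1 (p - 1)) (- H1 (p - 1) - of_nat p * H2 (p - 1))"
    using H1_reflect[of "p - 1"] gt3 by simp
  moreover have "J 2 (of_nat p * H2 (p - 1))"
    using J_p_mult[OF H2_full] by (simp add: numeral_2_eq_2)
  ultimately have "J 2 ((H1 (p - 1) - (- H1 (p - 1) - of_nat p * H2 (p - 1))) - of_nat p * H2 (p - 1))"
    by (rule J_diff)
  hence "J 2 ((H1 (p - 1) + H1 (p - 1)) / 2)" by (intro J_divide_2) simp
  thus ?thesis by simp
qed

section \<open>Euler numbers and the harmonic sums up to \<open>p div 4\<close>\<close>

lemma alternating_sum:
  "(\<Sum>k = 1..n. (-1) ^ k * f k) = 2 * (\<Sum>k = 1..n div 2. f (2 * k)) - sum f {1..n}" for f :: "nat \<Rightarrow> rat"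
proof (induction n)
  case (Suc n)
  show ?case
  proof (cases "even n")
    case True
    thus ?thesis using Suc by simp
  next
    case False
    hence "Suc n div 2 = Suc (n div 2)" "2 * Suc (n div 2) = Suc n" by (auto elim!: oddE)
    thus ?thesis using Suc False by simp
  qed
qed simp

text \<open>By Euler's theorem \<open>(2 k) ^ (n + s)\<close> is 1 modulo \<open>p ^ m\<close>. This
  turns the alternating power sums of the Euler polynomials into harmonic sums.\<close>

lemma power_totient:
  assumes "0 < k" "k < p" "totient (p ^ m) dvd n + s" 
  shows "eqv m (of_nat (2 * k) ^ n) (1 / of_nat (2 * k) ^ s)"
proof -
  have k: "\<not> p dvd 2 * k"
    using assms prime gt3 prime_dvd_mult_iff[of p 2 k] nat_dvd_not_less[of k p] nat_dvd_not_less[of 2 p] by auto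
  hence "coprime (2 * k) (p ^ m)"
    using prime prime_imp_coprime[of p "2 * k"] by (simp add: coprime_commute)
  hence "[(2 * k) ^ totient (p ^ m) = 1] (mod p ^ m)"
    by (rule euler_theorem)
  moreover obtain d where d: "n + s = totient (p ^ m) * d" using assms(3) by blast
  ultimately have "[(2 * k) ^ (n + s) = 1] (mod p ^ m)"
    using cong_pow[of "(2 * k) ^ totient (p ^ m)" 1 "p ^ m" d] by (simp add: power_mult)
  hence "int (p ^ m) dvd int ((2 * k) ^ (n + s)) - int 1"
    by (simp only: cong_int_iff[symmetric] cong_iff_dvd_diff)
  then obtain c where "int ((2 * k) ^ (n + s)) - int 1 = int (p ^ m) * c" by blast
  hence "of_int (int ((2 * k) ^ (n + s)) - int 1) = (of_int (int (p ^ m) * c) :: rat)" by (rule arg_cong)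
  hence "of_nat (2 * k) ^ (n + s) - 1 = (of_nat p ^ m * of_int c :: rat)"
    by simp
  hence "of_nat (2 * k) ^ n - 1 / of_nat (2 * k) ^ s = (of_nat p ^ m * of_int c / of_int (int ((2 * k) ^ s)) :: rat)"
    using assms(1) by (simp add: field_simps power_add)
  also have "J m \<dots>"
  proof (intro J_divide_int J_mult_right[OF J_p_power] J_of_int)
    show "\<not> int p dvd int ((2 * k) ^ s)"
      using k prime prime_dvd_power by (metis int_dvd_int_iff)
  qed
  finally show ?thesis .
qed

lemma eqv_of_int: "int p ^ m dvd a - b \<Longrightarrow> eqv m (of_int a) (of_int b)"
proof -
  assume "int p ^ m dvd a - b"
  then obtain c where "a - b = int p ^ m * c" by blast
  hence "of_int (a - b) = (of_int (int p ^ m * c) :: rat)" by (rule arg_cong)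
  thus ?thesis using J_mult_right[OF J_p_power J_of_int, of m c] by simp
qed

lemma euler_sum_telescope_rat:
  "of_int (euler_sum n 1) - (-1) ^ M * of_int (euler_sum n (2 * int M + 1))
     = - 2 * (\<Sum>k = 1..M. (-1) ^ k * of_nat (2 * k) ^ n :: rat)"
  using arg_cong[OF euler_sum_telescope[of n M], of "of_int :: int \<Rightarrow> rat"] by simp

text \<open>Modulo \<open>p\<close> the value \<open>euler_sum n p\<close> reduces to
  \<open>euler_sum n 0\<close>, the Euler number. Telescoping up to \<open>half\<close> ends at
  \<open>2 * half + 1 = p\<close> and starts from \<open>euler_sum n 1 = 0\<close>, so that value is
  an alternating sum of inverse squares. The index is kept general because two indices are needed
  later.\<close>

lemma euler_number_even_cong:
  assumes "even n" "n > 0" "(p - 1) dvd n + 2"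
  shows "eqv 1 (of_int (euler_number n)) (chi / 4 * H2 (p div 4))"
proof -
  obtain n' where n': "n = Suc n'" using assms(2) by (cases n) auto
  have "int p ^ 2 dvd euler_sum n (int p) - (euler_number n + int p * (int n * euler_sum n' 0))"
    using euler_sum_taylor[of "int p" n' 0] unfolding n' by (simp add: euler_sum_0)
  hence "int p dvd euler_sum n (int p) - (euler_number n + int p * (int n * euler_sum n' 0))"
    by (metis dvd_mult_left power2_eq_square)
  hence "int p dvd euler_sum n (int p) - (euler_number n + int p * (int n * euler_sum n' 0)) + int p * (int n * euler_sum n' 0)"
    by (rule dvd_add) simp
  hence 1: "eqv 1 (of_int (euler_sum n (int p))) (of_int (euler_number n))"
    by (intro eqv_of_int) (simp add: algebra_simps)
  have "- (chi * of_int (euler_sum n (int p))) = - 2 * (\<Sum>k = 1..half. (-1) ^ k * of_nat (2 * k) ^ n :: rat)"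
    using euler_sum_telescope_rat[of n half] unfolding half_props(3) euler_sum_1[OF assms(1,2)]
    by simp
  \<comment> \<open>Multiplying by \<open>chi\<close> solves for the Euler polynomial value, as
    \<open>chi * chi = 1\<close>.\<close>
  hence "chi * (chi * of_int (euler_sum n (int p))) = chi * (2 * (\<Sum>k = 1..half. (-1) ^ k * of_nat (2 * k) ^ n :: rat))"
    by simp
  hence 2: "of_int (euler_sum n (int p)) = chi * (2 * (\<Sum>k = 1..half. (-1) ^ k * of_nat (2 * k) ^ n :: rat))"
    by (simp only: mult.assoc[symmetric] chi_square mult_1)
  have "eqv 1 (\<Sum>k = 1..half. (-1) ^ k * of_nat (2 * k) ^ n :: rat) (\<Sum>k = 1..half. (-1) ^ k * (1 / of_nat (2 * k) ^ 2))"
  proof (intro eqv_sum)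
    fix k assume "k \<in> {1..half}"
    hence "eqv 1 (of_nat (2 * k) ^ n) (1 / of_nat (2 * k) ^ 2)"
      using assms(3) prime by (intro power_totient) (auto simp: totient_prime)
    hence "J 1 ((-1) ^ k * (of_nat (2 * k) ^ n - 1 / of_nat (2 * k) ^ 2))"
      by (intro J_mult_left J_power J_minus J_one)
    thus "eqv 1 ((-1) ^ k * of_nat (2 * k) ^ n :: rat) ((-1) ^ k * (1 / of_nat (2 * k) ^ 2))"
      by (simp only: right_diff_distrib)
  qed
  also have "(\<Sum>k = 1..half. (-1) ^ k * (1 / of_nat (2 * k) ^ 2)) = 1 / 4 * (\<Sum>k = 1..half. (-1) ^ k * (1 / of_nat k ^ 2) :: rat)"
    by (simp add: sum_distrib_left power_mult_distrib mult_ac)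
  also have "(\<Sum>k = 1..half. (-1) ^ k * (1 / of_nat k ^ 2) :: rat) = H2 (p div 4) / 2 - H2 half"
    unfolding alternating_sum half_div_2 by (simp add: sum_divide_distrib sum_distrib_left power_mult_distrib mult_ac)
  finally have "eqv 1 (\<Sum>k = 1..half. (-1) ^ k * of_nat (2 * k) ^ n :: rat) (1 / 4 * (H2 (p div 4) / 2 - H2 half))" .
  hence "J 1 ((\<Sum>k = 1..half. (-1) ^ k * of_nat (2 * k) ^ n :: rat) - 1 / 4 * (H2 (p div 4) / 2 - H2 half) - H2 half / 4)"
    using H2_half by (intro J_diff[of _ "_ - _"] J_divide_4)
  hence "J 1 ((chi * 2) * ((\<Sum>k = 1..half. (-1) ^ k * of_nat (2 * k) ^ n :: rat) - 1 / 4 * (H2 (p div 4) / 2 - H2 half) - H2 half / 4))"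
    by (intro J_mult_left[of "chi * 2"] J_mult_left[of chi 0] J_chi J_numeral)
  hence "eqv 1 (of_int (euler_sum n (int p))) (chi / 4 * H2 (p div 4))"
    unfolding 2 by (simp add: algebra_simps)
  thus ?thesis using eqv_trans[OF eqv_sym[OF 1]] by blast
qed

lemma euler_number_p_minus_3: "eqv 1 (H2 (p div 4)) (4 * chi * of_int (euler_number (p - 3)))"
proof -
  have "p - 3 + 2 = p - 1" "even (p - 3)" "p - 3 > 0" using gt3 odd_p by auto
  hence "eqv 1 (chi / 4 * H2 (p div 4)) (of_int (euler_number (p - 3)))"
    by (intro eqv_sym[OF euler_number_even_cong]) auto
  hence "J 1 ((4 * chi) * (chi / 4 * H2 (p div 4) - of_int (euler_number (p - 3))))"
    by (intro J_mult_left[of "4 * chi"] J_mult_left[of 4 0] J_numeral J_chi)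
  also have "(4 * chi) * (chi / 4 * H2 (p div 4) - of_int (euler_number (p - 3)))
     = (chi * chi) * H2 (p div 4) - 4 * chi * of_int (euler_number (p - 3))"
    by (simp add: algebra_simps)
  finally show ?thesis unfolding chi_square by simp
qed

lemma H1_quarter:
  "eqv 2 (H1 (p div 4)) (3 / 2 * H1 half - chi * of_nat p * of_int (euler_number (p - 3)))"
proof -
  \<comment> \<open>With this choice \<open>Suc N + 1\<close> is the totient of \<open>p^2\<close>,
    so powers of exponent \<open>Suc N\<close> act as reciprocals modulo \<open>p^2\<close>; also
    \<open>N + 2\<close> is a multiple of \<open>p - 1\<close>, as
    \<open>euler_number_even_cong\<close> requires.\<close>
  define N where "N = p * (p - 1) - 2"
  have "p * (p - 1) \<ge> 4 * 3" using gt3 by (intro mult_mono) auto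
  hence N: "N + 2 = p * (p - 1)" "N > 0" unfolding N_def by auto
  have evenN: "even N" using N(1) odd_p by (metis even_add even_diff_nat even_mult_iff even_numeral odd_one)
  have tot: "totient (p ^ 2) = p * (p - 1)"
    using totient_prime_power[OF prime, of 2] by simp
  let ?g = "\<lambda>x. of_int (euler_sum (Suc N) x) :: rat"
  let ?E = "\<lambda>n. of_int (euler_number n) :: rat"
  \<comment> \<open>At 0 the Euler number of odd index \<open>Suc N\<close> vanishes, so the linear
    Taylor term remains; its factor \<open>Suc N\<close> is -1 modulo \<open>p\<close>.\<close>
  have 1: "eqv 2 (?g (int p)) (- of_nat p * ?E N)"
  proof (rule eqv_trans[OF eqv_of_int])
    show "int p ^ 2 dvd euler_sum (Suc N) (int p) - int p * (int (Suc N) * euler_number N)"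
      using euler_sum_taylor[of "int p" N 0] euler_number_odd[of "Suc N"] evenN by (simp add: euler_sum_0)
    have "int (N + 2) = int p * (int p - 1)" unfolding N(1) using gt3 by (simp add: of_nat_diff)
    hence N': "int N = int p * (int p - 1) - 2" by simp
    have "int p * (int (Suc N) * euler_number N) - (- int p * euler_number N) = int p ^ 2 * ((int p - 1) * euler_number N)"
      unfolding of_nat_Suc N' by (simp add: algebra_simps power2_eq_square)
    hence "eqv 2 (of_int (int p * (int (Suc N) * euler_number N))) (of_int (- int p * euler_number N))"
      by (intro eqv_of_int) simp
    thus "eqv 2 (of_int (int p * (int (Suc N) * euler_number N))) (- of_nat p * ?E N)" by simp
  qed
  \<comment> \<open>The linear Taylor term at 1 contains \<open>euler_sum N 1\<close>, which is 0
    since \<open>N\<close> is even and positive.\<close>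
  have 2: "eqv 2 (?g (2 * int p + 1)) (?g 1)"
  proof (rule eqv_of_int)
    have "(2 * int p) ^ 2 dvd euler_sum (Suc N) (1 + 2 * int p) - euler_sum (Suc N) 1"
      using euler_sum_taylor[of "2 * int p" N 1] euler_sum_1[OF evenN N(2)] by simp
    thus "int p ^ 2 dvd euler_sum (Suc N) (2 * int p + 1) - euler_sum (Suc N) 1"
      by (simp add: power_mult_distrib add.commute dvd_mult_right)
  qed
  have S: "eqv 2 (\<Sum>k = 1..M. (-1) ^ k * of_nat (2 * k) ^ Suc N) ((H1 (M div 2) - H1 M) / 2)" if "M < p" for M
  proof -
    have "eqv 2 (\<Sum>k = 1..M. (-1) ^ k * of_nat (2 * k) ^ Suc N) (\<Sum>k = 1..M. (-1) ^ k * (1 / of_nat (2 * k) ^ 1))"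
    proof (intro eqv_sum)
      fix k assume "k \<in> {1..M}"
      hence "eqv 2 (of_nat (2 * k) ^ Suc N) (1 / of_nat (2 * k) ^ 1)"
        using that N by (intro power_totient) (auto simp: tot)
      hence "J 2 ((-1) ^ k * (of_nat (2 * k) ^ Suc N - 1 / of_nat (2 * k) ^ 1))"
        by (intro J_mult_left J_power J_minus J_one)
      thus "eqv 2 ((-1) ^ k * of_nat (2 * k) ^ Suc N :: rat) ((-1) ^ k * (1 / of_nat (2 * k) ^ 1))"
        by (simp only: right_diff_distrib)
    qed
    also have "(\<Sum>k = 1..M. (-1) ^ k * (1 / of_nat (2 * k) ^ 1)) = (\<Sum>k = 1..M. (-1) ^ k * (1 / of_nat k)) / (2 :: rat)"
      by (simp add: sum_divide_distrib mult_ac)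
    also have "(\<Sum>k = 1..M. (-1) ^ k * (1 / of_nat k)) = H1 (M div 2) - H1 M"
      unfolding alternating_sum by (simp add: sum_distrib_left)
    finally show ?thesis .
  qed
  \<comment> \<open>The odd degree leaves \<open>?g 1\<close> unknown. Telescoping up to
    \<open>p\<close> determines it through 2: the term \<open>k = p\<close> is divisible by
    \<open>p^2\<close>, and \<open>H1 (p - 1)\<close> vanishes modulo \<open>p^2\<close>.\<close>
  have 3: "eqv 2 (?g 1 + ?g (2 * int p + 1)) (- H1 half)"
  proof -
    have p: "{1..p} = insert p {1..p - 1}" using gt3 by auto
    have e1: "?g 1 + ?g (2 * int p + 1) = - 2 * (\<Sum>k = 1..p. (-1) ^ k * of_nat (2 * k) ^ Suc N)"
      using euler_sum_telescope_rat[of "Suc N" p] odd_p by simp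
    have e2: "(\<Sum>k = 1..p. (-1) ^ k * of_nat (2 * k) ^ Suc N) = (\<Sum>k = 1..p - 1. (-1) ^ k * of_nat (2 * k) ^ Suc N) - (2 * of_nat p :: rat) ^ Suc N"
      unfolding p using gt3 odd_p by (subst sum.insert) auto
    have "J 2 ((2 * of_nat p) ^ Suc N)"
      unfolding power_mult_distrib using N(2)
      by (intro J_mult_left J_power J_numeral J_mono[OF J_p_power]) auto
    moreover have "J 2 (H1 (p - 1) / 2)" using H1_full by (rule J_divide_2)
    moreover have "J 2 ((\<Sum>k = 1..p - 1. (-1) ^ k * of_nat (2 * k) ^ Suc N) - (H1 half - H1 (p - 1)) / 2)"
      using S[of "p - 1"] gt3 by simp
    ultimately have "J 2 ((- 2) * ((\<Sum>k = 1..p - 1. (-1) ^ k * of_nat (2 * k) ^ Suc N) - (H1 half - H1 (p - 1)) / 2 - (H1 (p - 1) / 2 + (2 * of_nat p) ^ Suc N)))"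
      by (intro J_mult_left[of "-2"] J_minus J_numeral J_diff[of _ "_ - _ / 2"] J_add)
    thus ?thesis unfolding e1 e2 by (simp add: algebra_simps diff_divide_distrib)
  qed
  have 4: "eqv 2 (?g 1 - chi * ?g (int p)) (H1 half - H1 (p div 4))"
  proof -
    have "?g 1 - chi * ?g (int p) = - 2 * (\<Sum>k = 1..half. (-1) ^ k * of_nat (2 * k) ^ Suc N)"
      using euler_sum_telescope_rat[of "Suc N" half] unfolding half_props(3) .
    moreover have "J 2 ((- 2) * ((\<Sum>k = 1..half. (-1) ^ k * of_nat (2 * k) ^ Suc N) - (H1 (p div 4) - H1 half) / 2))"
      using S[OF half_props(2)] unfolding half_div_2 by (intro J_mult_left[of "-2"] J_minus J_numeral) simp
    moreover have "(- 2) * (X - (a - b) / 2) = - 2 * X - (b - a)" for X a b :: rat by simp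
    ultimately show ?thesis by (simp only:)
  qed
  \<comment> \<open>A case of Kummer's congruence: both Euler numbers are congruent modulo
    \<open>p\<close> to the same multiple of \<open>H2 (p div 4)\<close>, and the factor
    \<open>p\<close> lifts this to \<open>p^2\<close>.\<close>
  have 5: "eqv 2 (of_nat p * ?E N) (of_nat p * ?E (p - 3))"
  proof -
    have "p - 3 + 2 = p - 1" "even (p - 3)" "p - 3 > 0" using gt3 odd_p by auto
    hence "eqv 1 (?E (p - 3)) (chi / 4 * H2 (p div 4))"
      by (intro euler_number_even_cong) auto
    moreover have "eqv 1 (?E N) (chi / 4 * H2 (p div 4))"
      using evenN N by (intro euler_number_even_cong) auto
    ultimately have "eqv 1 (?E N) (?E (p - 3))"
      using eqv_trans eqv_sym by blast
    thus ?thesis using J_p_mult[of 1] by (fastforce simp: numeral_2_eq_2 right_diff_distrib)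
  qed
  from 2 3 have "J 2 (((?g 1 + ?g (2 * int p + 1)) - (- H1 half) - (?g (2 * int p + 1) - ?g 1)) / 2)"
    by (intro J_divide_2 J_diff[of _ "_ - - _"])
  hence 6: "J 2 (?g 1 + H1 half / 2)" by (simp add: add_divide_distrib)
  have "J 2 ((?g 1 - chi * ?g (int p)) - (H1 half - H1 (p div 4)) + chi * (?g (int p) - (- of_nat p * ?E N))
     - (?g 1 + H1 half / 2) - chi * (of_nat p * ?E N - of_nat p * ?E (p - 3)))"
    by (intro J_diff[OF J_diff[OF J_add[OF 4 J_mult_left[OF J_chi 1]] 6] J_mult_left[OF J_chi 5]])
  thus ?thesis by (simp add: algebra_simps)
qed

section \<open>The harmonic sum up to \<open>half\<close> and the Fermat quotient\<close>

text \<open>Modulo \<open>p^3\<close> only the first two elementary symmetric functions count; the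
  second is half the square of the sum minus half the sum of squares.\<close>

lemma prod_expand:
  fixes c :: "nat \<Rightarrow> rat"
  assumes "\<forall>k\<in>{1..n}. J 0 (c k)"
  shows "eqv 3 (\<Prod>k = 1..n. 1 + of_nat p * c k)
    (1 + of_nat p * sum c {1..n} + of_nat p ^ 2 * ((sum c {1..n})\<^sup>2 - (\<Sum>k = 1..n. (c k)\<^sup>2)) / 2)"
  using assms
proof (induction n)
  case (Suc n)
  define A S T x where "A = (\<Prod>k = 1..n. 1 + of_nat p * c k)" and "S = sum c {1..n}"
    and "T = (\<Sum>k = 1..n. (c k)\<^sup>2)" and "x = c (Suc n)"
  have x: "J 0 x" and ST: "J 0 S" "J 0 T"
    using Suc.prems unfolding x_def S_def T_def by (auto intro!: J_sum J_power)
  have IH: "eqv 3 A (1 + of_nat p * S + of_nat p ^ 2 * (S\<^sup>2 - T) / 2)"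
    unfolding A_def S_def T_def using Suc by simp
  have "A * (1 + of_nat p * x) - (1 + of_nat p * (S + x) + of_nat p ^ 2 * ((S + x)\<^sup>2 - (T + x\<^sup>2)) / 2)
     = (1 + of_nat p * x) * (A - (1 + of_nat p * S + of_nat p ^ 2 * (S\<^sup>2 - T) / 2))
       + of_nat p ^ 3 * (x * ((S\<^sup>2 - T) / 2))"
    by (simp add: field_simps power2_eq_square power3_eq_cube)
  also have "J 3 \<dots>"
    by (intro J_add J_mult_left[OF _ IH] J_mult_right[OF J_p_power] J_one J_mult_left[of "of_nat p"]
        J_mult_left[of x] J_of_nat x J_divide_2 J_diff J_power ST)
  finally show ?case
    unfolding A_def S_def T_def x_def by (simp add: add_ac)
qed simp

text \<open>The factors are \<open>- (p - k) / k\<close> and \<open>- (p - 2 k) / (2 k)\<close>.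
  Factoring \<open>(p - 1)!\<close> by reflection as \<open>A * B\<close> and by parity as
  \<open>2 ^ half * A * C\<close> gives \<open>B = 2 ^ half * C\<close>.\<close>

lemma half_product:
  "(\<Prod>k = 1..half. 1 + of_nat p * (- (1 / of_nat k)))
     = (2 ^ (p - 1) * (\<Prod>k = 1..half. 1 + of_nat p * (- (1 / of_nat (2 * k)))) :: rat)"
proof -
  define A B C where "A = (\<Prod>k = 1..half. of_nat k :: rat)"
    and "B = (\<Prod>k = 1..half. of_nat (p - k) :: rat)"
    and "C = (\<Prod>k = 1..half. of_nat (p - 2 * k) :: rat)"
  have p: "half + half = p - 1" "2 * half = p - 1" "p - 1 + 1 = p"
    using odd_p gt3 by (auto elim!: oddE)
  have "A \<noteq> 0" unfolding A_def by auto
  have "A * B = (\<Prod>k = 1..half. of_nat (2 * k)) * C"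
    unfolding A_def B_def C_def
    using prod.split_reflect[of "of_nat :: nat \<Rightarrow> rat" half half]
      prod.split_even_odd[of "of_nat :: nat \<Rightarrow> rat" half] unfolding p by simp
  also have "(\<Prod>k = 1..half. of_nat (2 * k)) = 2 ^ half * A"
    unfolding A_def by (simp add: prod.distrib)
  finally have B: "B = 2 ^ half * C" using \<open>A \<noteq> 0\<close> by simp
  have "(\<Prod>k = 1..half. 1 + of_nat p * (- (1 / of_nat k))) = (\<Prod>k = 1..half. (-1) * of_nat (p - k) / of_nat k :: rat)"
    by (intro prod.cong refl) (auto simp: field_simps of_nat_diff)
  also have "\<dots> = (-1) ^ half * B / A"
    unfolding A_def B_def prod_dividef prod.distrib by simp
  finally have 1: "(\<Prod>k = 1..half. 1 + of_nat p * (- (1 / of_nat k))) = (-1) ^ half * B / A" .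
  have "(\<Prod>k = 1..half. 1 + of_nat p * (- (1 / of_nat (2 * k)))) = (\<Prod>k = 1..half. (-1) * of_nat (p - 2 * k) / (2 * of_nat k) :: rat)"
    by (intro prod.cong refl) (auto simp: field_simps of_nat_diff)
  also have "\<dots> = (-1) ^ half * C / (2 ^ half * A)"
    unfolding A_def C_def prod_dividef prod.distrib by simp
  finally have 2: "(\<Prod>k = 1..half. 1 + of_nat p * (- (1 / of_nat (2 * k)))) = (-1) ^ half * C / (2 ^ half * A)" .
  have "(2 :: rat) ^ (p - 1) = 2 ^ half * 2 ^ half"
    by (simp only: p(1) flip: power_add)
  thus ?thesis unfolding 1 2 B by simp
qed

lemma two_power: "2 ^ (p - 1) = 1 + of_nat p * fermat_quotient p 2"
  unfolding fermat_quotient_def using gt3 by simp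

lemma J_fermat_quotient [simp, intro]: "J 0 (fermat_quotient p 2)"
proof -
  have "[2 ^ (p - 1) = 1] (mod p)"
    using fermat_theorem[OF prime, of 2] gt3 nat_dvd_not_less[of 2 p] by simp
  hence "int p dvd int (2 ^ (p - 1)) - int 1"
    by (simp only: cong_int_iff[symmetric] cong_iff_dvd_diff)
  hence "J 1 (of_int (int (2 ^ (p - 1))) - of_int (int 1))"
    by (intro eqv_of_int) simp
  hence "J 1 (of_nat p * fermat_quotient p 2)"
    using two_power by simp
  thus ?thesis using J_p_mult_iff[of 0] by simp
qed

lemma H1_half: "eqv 2 (H1 half) (- 2 * fermat_quotient p 2 + of_nat p * fermat_quotient p 2 ^ 2)"
proof -
  define P Q S T :: rat where "P = of_nat p" and "Q = fermat_quotient p 2" and "S = H1 half" and "T = H2 half"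
  define L R where "L = (\<Prod>k = 1..half. 1 + P * (- (1 / of_nat k)))"
    and "R = (\<Prod>k = 1..half. 1 + P * (- (1 / of_nat (2 * k))))"
  have JQ: "J 0 Q" and JS: "J 0 S" and JT: "J 1 T" and JP: "J 1 P" and JP0: "J 0 P"
    unfolding Q_def S_def T_def P_def using H2_half J_H1[OF half_props(2)] by auto
  have JPP: "J 2 (P\<^sup>2)" using J_p_power[of 2] by (simp add: P_def)
  have LR: "L = (1 + P * Q) * R"
    unfolding L_def R_def P_def half_product two_power Q_def ..
  have "sum (\<lambda>k. - (1 / of_nat k)) {1..half} = - S" "(\<Sum>k = 1..half. (- (1 / of_nat k))\<^sup>2) = T"
    unfolding S_def T_def by (simp_all add: sum_negf power_divide)
  hence 1: "eqv 3 L (1 - P * S + P\<^sup>2 * (S\<^sup>2 - T) / 2)"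
    using prod_expand[of half "\<lambda>k. - (1 / of_nat k)"] unfolding L_def P_def
    by (fastforce intro!: J_minus J_divide_nat)
  have "sum (\<lambda>k. - (1 / of_nat (2 * k))) {1..half} = - S / 2" "(\<Sum>k = 1..half. (- (1 / of_nat (2 * k)))\<^sup>2) = T / 4"
    unfolding S_def T_def by (simp_all add: sum_negf sum_divide_distrib power_divide power_mult_distrib mult_ac)
  hence 2: "eqv 3 R (1 - P * S / 2 + P\<^sup>2 * (S\<^sup>2 / 4 - T / 4) / 2)"
    using prod_expand[of half "\<lambda>k. - (1 / of_nat (2 * k))"] unfolding R_def P_def
    by (fastforce intro!: J_minus J_divide_nat simp del: of_nat_mult simp: power_divide)
  \<comment> \<open>\<open>Z\<close> is the difference of the two expansions in
    \<open>half_product\<close> divided by \<open>p\<close>, without the terms in \<open>T\<close>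
    and \<open>P\<^sup>2 * (Q * (S\<^sup>2 / 8))\<close>, which are negligible modulo
    \<open>p^2\<close>.\<close>
  define Z where "Z = - S / 2 - Q + 3 / 8 * P * S\<^sup>2 + P * Q * S / 2"
  have PT: "J 3 (P\<^sup>2 * T)" using J_mult[OF JPP JT] by (simp add: numeral_3_eq_3 numeral_2_eq_2)
  have "P * (Z - P\<^sup>2 * (Q * (S\<^sup>2 / 8))) = (1 + P * Q) * (R - (1 - P * S / 2 + P\<^sup>2 * (S\<^sup>2 / 4 - T / 4) / 2))
       - (L - (1 - P * S + P\<^sup>2 * (S\<^sup>2 - T) / 2)) + P\<^sup>2 * T / 2 - (1 + P * Q) * (P\<^sup>2 * T / 8)"
    unfolding LR Z_def by (simp add: field_simps power2_eq_square)
  also have "J 3 \<dots>"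
    by (intro J_diff[of _ "_ + _"] J_add[of 3] J_diff[OF J_mult_left[OF _ 2] 1] J_mult_left[of "1 + P * Q"]
      J_add[of 0] J_one J_mult_left[of P 0 Q] JP0 JQ J_divide_2 J_divide_8 PT)
  finally have "J (Suc 2) (of_nat p * (Z - P\<^sup>2 * (Q * (S\<^sup>2 / 8))))"
    by (simp add: P_def numeral_3_eq_3)
  hence 3: "J 2 (Z - P\<^sup>2 * (Q * (S\<^sup>2 / 8)))"
    by (simp only: J_p_mult_iff)
  have "J 2 (P\<^sup>2 * (Q * (S\<^sup>2 / 8)))"
    using J_mult_right[OF JPP, of "Q * (S\<^sup>2 / 8)"] JQ JS by blast
  from J_add[OF 3 this] have Z: "J 2 Z" by (simp only: diff_add_cancel)
  \<comment> \<open>Bootstrapping: \<open>Z\<close> modulo \<open>p\<close> gives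
    \<open>S = - 2 Q\<close>, so \<open>P * e\<close> vanishes modulo \<open>p^2\<close> and
    \<open>S\<close> may be replaced by \<open>- 2 Q\<close> in the terms of \<open>Z\<close> that
    carry a factor \<open>P\<close>.\<close>
  define e where "e = S + 2 * Q"
  have "e = P * (2 * (3 * S\<^sup>2 / 8) + Q * S) - 2 * Z"
    unfolding e_def Z_def by (simp add: field_simps)
  also have "J 1 \<dots>"
    by (intro J_diff J_mult_right[OF JP] J_add J_mult_left[of 2] J_mult_left[of Q] J_divide_8 J_mult_left[of 3]
        J_numeral J_power JS JQ J_mono[OF Z]) simp
  finally have e: "J 1 e" .
  have Pe: "J 2 (P * e)" using J_mult[OF JP e] by (simp add: numeral_2_eq_2)
  have "S - (- 2 * Q + P * Q\<^sup>2) = 2 * (P * e * (3 * (S - 2 * Q) / 8 + Q / 2) - Z)"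
    unfolding e_def Z_def by (simp add: field_simps power2_eq_square)
  also have "J 2 \<dots>"
    by (intro J_mult_left[of 2] J_diff[of 2] J_mult_right[OF Pe] J_add J_divide_8 J_divide_2 J_mult_left[of 3]
         J_mult_left[of 2 0 Q] J_diff[of 0] J_numeral JS JQ Z)
  finally show ?thesis unfolding S_def Q_def P_def .
qed

section \<open>The binomial sum as a function of its upper argument\<close>

definition F :: "rat \<Rightarrow> rat" where
  "F a = (\<Sum>k = 1..p - 1. (- 1) ^ k / of_nat k * (a gchoose k))"

text \<open>Pascal's rule and absorption turn each difference of terms into
  \<open>(-1)^k (a gchoose k) / a\<close>, which removes the denominator \<open>k\<close>;
  alternating partial row sums have a closed form.\<close>

lemma F_step:
  assumes "a \<noteq> 0"
  shows "F a - F (a - 1) = ((a - 1 gchoose (p - 1)) - 1) / a"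
proof -
  have "(- 1) ^ k / of_nat k * (a gchoose k) - (- 1) ^ k / of_nat k * (a - 1 gchoose k)
      = (a gchoose k) * (- 1) ^ k / a" if k_range: "k \<in> {1..p - 1}" for k
  proof -
    obtain k' where k: "k = Suc k'" using k_range by (cases k) auto
    have "(a gchoose k) - (a - 1 gchoose k) = (a - 1 gchoose k')"
      using gbinomial_Suc_Suc[of "a - 1" k'] by (simp add: k)
    moreover have "of_nat k * (a gchoose k) = a * (a - 1 gchoose k')"
      unfolding k by (rule gbinomial_absorption)
    ultimately have *: "of_nat k * (a gchoose k) = a * ((a gchoose k) - (a - 1 gchoose k))" by simp
    have "(- 1) ^ k / of_nat k * (a gchoose k) - (- 1) ^ k / of_nat k * (a - 1 gchoose k)
      = (a * ((a gchoose k) - (a - 1 gchoose k))) * (- 1) ^ k / (of_nat k * a)"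
      using assms by (simp add: k field_simps del: of_nat_Suc)
    also have "\<dots> = (a gchoose k) * (- 1) ^ k / a"
      unfolding *[symmetric] by (simp add: k del: of_nat_Suc)
    finally show ?thesis .
  qed
  hence "F a - F (a - 1) = (\<Sum>k = 1..p - 1. (a gchoose k) * (- 1) ^ k) / a"
    unfolding F_def sum_subtractf[symmetric] sum_divide_distrib by (rule sum.cong[OF refl])
  also have "(\<Sum>k = 1..p - 1. (a gchoose k) * (- 1) ^ k) = (\<Sum>k \<le> p - 1. (a gchoose k) * (- 1) ^ k) - 1"
    by (simp add: atMost_atLeast0 sum.atLeast_Suc_atMost)
  also have "(\<Sum>k \<le> p - 1. (a gchoose k) * (- 1) ^ k) = (- 1) ^ (p - 1) * (a - 1 gchoose (p - 1))"
    by (rule gbinomial_sum_lower_neg)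
  finally show ?thesis using odd_p by simp
qed

lemma gbinomial_Suc_right: "a gchoose Suc k = (a gchoose k) * (a - of_nat k) / of_nat (Suc k)" for a :: rat
  using gbinomial_mult_1[of a k] by (simp add: field_simps)

lemma minus_1_gbinomial: "(-1 :: rat) gchoose k = (-1) ^ k"
  by (induction k) (simp_all add: gbinomial_Suc_right field_simps del: of_nat_Suc, simp add: algebra_simps)

lemma J_gbinomial:
  assumes "J 0 a" "k < p"
  shows "J 0 (a gchoose k)"
  using assms(2)
proof (induction k)
  case (Suc k)
  thus ?case unfolding gbinomial_Suc_right
    by (intro J_divide_nat J_mult_left[of "a gchoose k"] J_diff[of 0 a] assms(1) J_of_nat) auto
qed simp

lemma gbinomial_cong:
  assumes "J 0 a" "J 0 b" "eqv 1 a b" "k < p"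
  shows "eqv 1 (a gchoose k) (b gchoose k)"
  using assms(4)
proof (induction k)
  case (Suc k)
  have "J 1 (((a gchoose k) * (a - of_nat k) - (b gchoose k) * (b - of_nat k)) / of_nat (Suc k))"
    using Suc assms by (intro J_divide_nat eqv_mult J_gbinomial J_diff[of 0 b]) auto
  thus ?case unfolding gbinomial_Suc_right by (simp only: diff_divide_distrib)
qed simp

context
  fixes t :: rat
  assumes t: "J 0 t"
begin

lemma J_pt: "J 1 (of_nat p * t)"
  using J_p_mult[OF t] by simp

text \<open>Absorption extracts the factor \<open>p t / k\<close>, so the remaining coefficient is
  needed only modulo \<open>p\<close>, where \<open>p t - 1\<close> may be replaced by
  \<open>-1\<close>.\<close>

lemma gbinomial_pt:
  assumes "0 < k" "k < p"
  shows "eqv 2 (of_nat p * t gchoose k) (- ((-1) ^ k * of_nat p * t / of_nat k))"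
proof -
  obtain k' where k: "k = Suc k'" using assms by (cases k) auto
  have "of_nat k * (of_nat p * t gchoose k) = of_nat p * t * (of_nat p * t - 1 gchoose k')"
    unfolding k by (rule gbinomial_absorption)
  hence "(of_nat p * t gchoose k) - (- ((-1) ^ k * of_nat p * t / of_nat k))
    = of_nat p * t * ((of_nat p * t - 1 gchoose k') - (-1 gchoose k')) / of_nat k"
    using assms by (simp add: minus_1_gbinomial field_simps k)
  also have "J 2 \<dots>"
  proof (intro J_divide_nat)
    have "eqv 1 (of_nat p * t - 1 gchoose k') (-1 gchoose k')"
      using assms k J_pt by (intro gbinomial_cong J_diff[OF J_0[OF J_pt]] J_one J_minus) auto
    thus "J 2 (of_nat p * t * ((of_nat p * t - 1 gchoose k') - (-1 gchoose k')))"
      using J_mult[OF J_pt] by (fastforce simp: numeral_2_eq_2)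
  qed (use assms in auto)
  finally show ?thesis .
qed

text \<open>The signs cancel against those of \<open>gbinomial_pt\<close>, leaving
  \<open>- p t\<close> times \<open>H2 (p - 1)\<close>, itself divisible by
  \<open>p\<close>.\<close>

lemma F_pt: "J 2 (F (of_nat p * t))"
proof -
  have "eqv 2 (F (of_nat p * t)) (\<Sum>k = 1..p - 1. - (of_nat p * t * (1 / of_nat k ^ 2)))"
    unfolding F_def
  proof (intro eqv_sum)
    fix k assume k: "k \<in> {1..p - 1}"
    have "J 2 ((-1) ^ k * ((of_nat p * t gchoose k) - (- ((-1) ^ k * of_nat p * t / of_nat k))) / of_nat k)"
      using k by (intro J_divide_nat J_mult_left[OF _ gbinomial_pt] J_power J_minus J_one) auto
    also have "(-1) ^ k * ((of_nat p * t gchoose k) - (- ((-1) ^ k * of_nat p * t / of_nat k))) / of_nat k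
      = (- 1) ^ k / of_nat k * (of_nat p * t gchoose k) - - (of_nat p * t * (1 / of_nat k ^ 2))"
      by (cases "even k") (simp_all add: add_divide_distrib diff_divide_distrib power2_eq_square mult_ac)
    finally show "J 2 \<dots>" .
  qed
  also have "(\<Sum>k = 1..p - 1. - (of_nat p * t * (1 / of_nat k ^ 2))) = - (of_nat p * t) * H2 (p - 1)"
    by (simp add: sum_distrib_left sum_negf)
  also have "eqv 2 (- (of_nat p * t) * H2 (p - 1)) 0"
    using J_mult[OF J_minus[OF J_pt] H2_full] by (simp add: numeral_2_eq_2)
  finally show ?thesis by simp
qed

lemma pt_add_divide:
  assumes "0 < j" "j < p" "J m x"
  shows "J m (x / (of_nat p * t + of_nat j))" "of_nat p * t + of_nat j \<noteq> 0"
  using J_divide_unit[of "of_nat p * t + of_nat j" "int j"] assms J_pt nat_dvd_not_less[of j p] by auto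

text \<open>Induction that really starts at 1, where \<open>gbinomial_pt\<close> applies and
  \<open>p - 1\<close> is -1 modulo \<open>p\<close>. Raising the upper argument by 1 multiplies the
  coefficient by \<open>(u + j) / v\<close>, with \<open>v\<close> a unit as
  \<open>Suc j < p\<close>.\<close>

lemma gbinomial_pt_add:
  assumes "0 < j" "j < p"
  shows "eqv 2 (of_nat p * t + of_nat j - 1 gchoose (p - 1)) (of_nat p * t / of_nat j)"
  using assms
proof (induction j)
  case (Suc j)
  show ?case
  proof (cases "j = 0")
    case True
    have "eqv 2 (of_nat p * t gchoose (p - 1)) (- (of_nat p * t / of_nat (p - 1)))"
      using gbinomial_pt[of "p - 1"] gt3 odd_p by simp
    also have "eqv 2 (- (of_nat p * t / of_nat (p - 1))) (of_nat p * t)"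
    proof -
      have "- (of_nat p * t / of_nat (p - 1)) - of_nat p * t = - (of_nat p ^ 2 * t / of_nat (p - 1))"
        using gt3 by (simp add: of_nat_diff field_simps power2_eq_square)
      also have "J 2 \<dots>"
        using gt3 t by (intro J_minus J_divide_nat J_mult_right[OF J_p_power]) auto
      finally show ?thesis .
    qed
    finally show ?thesis using True by simp
  next
    case False
    define u and X where "u = of_nat p * t" and "X = (u + of_nat j - 1 gchoose (p - 1))"
    define Y where "Y = (u + of_nat j gchoose (p - 1))"
    have u: "J 1 u" unfolding u_def by (rule J_pt)
    have X: "eqv 2 X (u / of_nat j)"
      using Suc False unfolding X_def u_def by simp
    define v where "v = u + of_nat (Suc j) - of_nat p"
    have *: "v * Y = (u + of_nat j) * X"
      using gbinomial_absorb_comp[of "u + of_nat j" "p - 1"] gt3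
      unfolding v_def Y_def X_def by (simp add: of_nat_diff algebra_simps)
    have v1: "eqv 1 v (of_int (int (Suc j)))" unfolding v_def using J_diff[of 1 u "of_nat p"] u J_p by simp
    have v: "v \<noteq> 0" "\<And>m x. J m x \<Longrightarrow> J m (x / v)"
      using J_divide_unit[OF v1] Suc.prems nat_dvd_not_less[of "Suc j" p]
      by (auto simp del: of_nat_Suc)
    have "(u + of_nat j) * (u / of_nat j) - v * (u / of_nat (Suc j)) = u * (u / of_nat j - (u - of_nat p) / of_nat (Suc j))"
      using False unfolding v_def by (simp add: add_divide_distrib diff_divide_distrib algebra_simps del: of_nat_Suc)
    hence "v * (Y - u / of_nat (Suc j)) = (u + of_nat j) * (X - u / of_nat j) + u * (u / of_nat j - (u - of_nat p) / of_nat (Suc j))"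
      by (simp only: right_diff_distrib * )
    hence "Y - u / of_nat (Suc j) = ((u + of_nat j) * (X - u / of_nat j) + u * (u / of_nat j - (u - of_nat p) / of_nat (Suc j))) / v"
      using v(1) by (simp only: eq_divide_eq mult.commute[of v]) simp
    also have "J 2 \<dots>"
    proof (rule v(2), rule J_add)
      show "J 2 ((u + of_nat j) * (X - u / of_nat j))"
        using J_0[OF u] X by (intro J_mult_left[of "u + of_nat j"] J_add[of 0] J_of_nat)
      have "J 1 (u / of_nat j - (u - of_nat p) / of_nat (Suc j))"
        using u False Suc.prems by (intro J_diff J_divide_nat) auto
      thus "J 2 (u * (u / of_nat j - (u - of_nat p) / of_nat (Suc j)))"
        using J_mult[OF u] by (fastforce simp: numeral_2_eq_2)
    qed
    finally show ?thesis unfolding Y_def u_def by simp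
  qed
qed simp

lemma F_pt_step:
  assumes "0 < j" "j < p"
  shows "eqv 2 (F (of_nat p * t + of_nat j) - F (of_nat p * t + of_nat j - 1))
     (- (1 / of_nat j) + 2 * of_nat p * t / of_nat j ^ 2)"
proof -
  define u a J' where "u = of_nat p * t" and "a = u + of_nat j" and "J' = (of_nat j :: rat)"
  define X where "X = (a - 1 gchoose (p - 1))"
  have X: "eqv 2 X (u / J')"
    using gbinomial_pt_add[OF assms] unfolding X_def u_def a_def J'_def by simp
  have a: "a \<noteq> 0" "\<And>m x. J m x \<Longrightarrow> J m (x / a)"
    unfolding a_def u_def using pt_add_divide[OF assms] by auto
  have "J 2 (u\<^sup>2)" using J_mult[OF J_pt J_pt] by (simp add: u_def power2_eq_square numeral_2_eq_2)
  \<comment> \<open>From \<open>(u / j - 1) / (u + j)\<close> expanded to first order in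
    \<open>u\<close>; the term \<open>2 * (u\<^sup>2 / J' ^ 2)\<close>, zero modulo
    \<open>p^2\<close>, makes the next identity exact.\<close>
  hence "J 2 ((X - u / J' - 2 * (u\<^sup>2 / J' ^ 2)) / a)"
    unfolding J'_def using X[unfolded J'_def] assms
    by (intro a(2) J_diff[of 2 "_ - _"] J_mult_left[of 2] J_numeral J_divide_nat_power)
  also have "(X - u / J' - 2 * (u\<^sup>2 / J' ^ 2)) / a = (X - 1) / a - (- (1 / J') + 2 * u / J' ^ 2)"
    using a(1) assms unfolding a_def J'_def[symmetric]
    by (simp add: divide_simps J'_def[symmetric]) (simp add: J'_def power2_eq_square algebra_simps)
  finally show ?thesis
    using F_step[OF a(1)] unfolding X_def u_def a_def J'_def by (simp add: mult_ac)
qed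

lemma F_pt_add:
  assumes "r < p"
  shows "eqv 2 (F (of_nat p * t + of_nat r)) (- H1 r + 2 * of_nat p * t * H2 r)"
  using assms
proof (induction r)
  case 0
  thus ?case using F_pt by simp
next
  case (Suc r)
  have "J 2 (F (of_nat p * t + of_nat r) - (- H1 r + 2 * of_nat p * t * H2 r)
     + (F (of_nat p * t + of_nat (Suc r)) - F (of_nat p * t + of_nat (Suc r) - 1)
        - (- (1 / of_nat (Suc r)) + 2 * of_nat p * t / of_nat (Suc r) ^ 2)))"
    using Suc F_pt_step[of "Suc r"] by (intro J_add) auto
  moreover have *: "of_nat p * t + of_nat (Suc r) - 1 = of_nat p * t + of_nat r" by simp
  have "H1 (Suc r) = H1 r + 1 / of_nat (Suc r)" "H2 (Suc r) = H2 r + 1 / of_nat (Suc r) ^ 2" by simp_all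
  ultimately show ?case
    unfolding * by (simp add: algebra_simps del: of_nat_Suc)
qed

end

text \<open>\<open>- 1 / 4\<close> equals \<open>- p / 4 + q\<close> if \<open>p = 4 q + 1\<close>,
  and \<open>- 3 p / 4 + (3 q + 2)\<close> if \<open>p = 4 q + 3\<close>. In the second case
  \<open>3 q + 2 = p - 1 - q\<close>, so reflection returns to sums up to \<open>q\<close>.\<close>

lemma F_minus_quarter: "eqv 2 (F (- 1 / 4)) (- H1 (p div 4) - chi * of_nat p / 2 * H2 (p div 4))"
proof (cases "p mod 4 = 1")
  case True
  have t: "J 0 (- 1 / 4)" by (intro J_divide_4 J_minus J_one)
  have "p = 4 * (p div 4) + 1" using True by presburger
  hence "(of_nat p :: rat) = of_nat (4 * (p div 4) + 1)" by (rule arg_cong)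
  hence "of_nat p * (- 1 / 4) + of_nat (p div 4) = (- 1 / 4 :: rat)" by (simp add: field_simps)
  moreover have "even half" using True by presburger
  ultimately show ?thesis
    using F_pt_add[OF t, of "p div 4"] gt3 by (simp add: div_less_dividend)
next
  case False
  hence mod: "p mod 4 = 3" using odd_p by presburger
  have t: "J 0 (- 3 / 4)" by (intro J_divide_4 J_minus J_numeral)
  define q where "q = p div 4"
  have q: "q < p" unfolding q_def using gt3 by simp
  have "p = 4 * q + 3" unfolding q_def using mod by presburger
  hence p: "(of_nat p :: rat) = of_nat (4 * q + 3)" "p - 1 - q = 3 * q + 2" by simp_all
  have arg: "of_nat p * (- 3 / 4) + of_nat (p - 1 - q) = (- 1 / 4 :: rat)" unfolding p by (simp add: field_simps)
  hence 1: "eqv 2 (F (- 1 / 4)) (- H1 (p - 1 - q) + 2 * of_nat p * (- 3 / 4) * H2 (p - 1 - q))"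
    using F_pt_add[OF t, of "p - 1 - q"] gt3 unfolding arg by simp
  have "odd half" using mod by presburger
  hence chi: "chi = -1" by simp
  have 2: "J 2 (H1 (p - 1 - q) - H1 q - of_nat p * H2 q)"
    using J_diff[OF H1_full H1_reflect[OF q]] by (simp add: algebra_simps)
  have "J 1 (H2 (p - 1 - q) + H2 q)"
    using J_diff[OF H2_full H2_reflect[OF q]] by simp
  hence 3: "J 2 (of_nat p * (H2 (p - 1 - q) + H2 q))"
    using J_p_mult by (fastforce simp: numeral_2_eq_2)
  have "J 2 (F (- 1 / 4) - (- H1 (p - 1 - q) + 2 * of_nat p * (- 3 / 4) * H2 (p - 1 - q))
     - (H1 (p - 1 - q) - H1 q - of_nat p * H2 q) - 3 * (of_nat p * (H2 (p - 1 - q) + H2 q)) / 2)"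
    by (intro J_diff[OF J_diff[OF 1 2]] J_divide_2 J_mult_left[of 3] J_numeral 3)
  moreover have "f - (- h' + 2 * P * (- 3 / 4) * s') - (h' - h - P * s) - 3 * (P * (s' + s)) / 2
     = f - (- h - -1 * P / 2 * s)" for f h h' s s' P :: rat
    by (simp add: field_simps)
  ultimately show ?thesis unfolding chi q_def[symmetric] by (simp only:)
qed

section \<open>The Legendre symbol and the final combination\<close>

text \<open>Euler's criterion gives a congruence; since \<open>p > 2\<close>, the values -1, 0, 1
  are distinct modulo \<open>p\<close>, so it is an equality.\<close>

lemma Legendre_minus_1: "of_int (Legendre (- 1) (int p)) = chi"
proof -
  have "[Legendre (- 1) (int p) = (- 1) ^ half] (mod int p)"
    using euler_criterion[of p "-1"] prime gt3 by simp
  moreover have "Legendre (- 1) (int p) \<in> {-1, 0, 1}" unfolding Legendre_def by simp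
  moreover have "\<not> [-1 = 0] (mod int p)" "\<not> [1 = -1] (mod int p)" "\<not> [-1 = 1] (mod int p)"
    using gt3 zdvd_not_zless[of 1 "int p"] zdvd_not_zless[of 2 "int p"] by (auto simp: cong_iff_dvd_diff)
  ultimately have "Legendre (- 1) (int p) = (- 1) ^ half"
    unfolding Legendre_def by (cases "even half") (auto split: if_splits simp: cong_sym_eq)
  thus ?thesis by simp
qed

lemma F_minus_quarter_cong:
  "eqv 2 (F (- 1 / 4)) (3 * fermat_quotient p 2 - 3 / 2 * of_nat p * fermat_quotient p 2 ^ 2
      - (2 - chi) * of_nat p * of_int (euler_number (p - 3)))"
proof -
  let ?Q = "fermat_quotient p 2" and ?E = "of_int (euler_number (p - 3)) :: rat"
  have 1: "J 2 (of_nat p * (H2 (p div 4) - 4 * chi * ?E))"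
    using J_p_mult[OF euler_number_p_minus_3] by (simp add: numeral_2_eq_2)
  \<comment> \<open>The sum over \<open>p div 4\<close> of reciprocals contributes
    \<open>chi p E\<close>, that of inverse squares \<open>- 2 chi^2 p E\<close>; with
    \<open>chi^2 = 1\<close> the coefficient is \<open>- (2 - chi)\<close>.\<close>
  have "J 2 (F (- 1 / 4) - (- H1 (p div 4) - chi * of_nat p / 2 * H2 (p div 4))
      - (H1 (p div 4) - (3 / 2 * H1 half - chi * of_nat p * ?E))
      - 3 * (H1 half - (- 2 * ?Q + of_nat p * ?Q ^ 2)) / 2
      - chi * (of_nat p * (H2 (p div 4) - 4 * chi * ?E)) / 2)"
    by (intro J_diff[OF J_diff[OF J_diff[OF F_minus_quarter H1_quarter]]] J_divide_2
        J_mult_left[OF J_numeral H1_half] J_mult_left[OF J_chi 1])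
  also have "F (- 1 / 4) - (- H1 (p div 4) - chi * of_nat p / 2 * H2 (p div 4))
      - (H1 (p div 4) - (3 / 2 * H1 half - chi * of_nat p * ?E))
      - 3 * (H1 half - (- 2 * ?Q + of_nat p * ?Q ^ 2)) / 2
      - chi * (of_nat p * (H2 (p div 4) - 4 * chi * ?E)) / 2
    = F (- 1 / 4) - (3 * ?Q - 3 / 2 * of_nat p * ?Q ^ 2 - (2 * (chi * chi) - chi) * of_nat p * ?E)"
    by (simp add: field_simps)
  finally show ?thesis unfolding chi_square by simp
qed

lemma J_F: "J 0 a \<Longrightarrow> J 0 (F a)"
  unfolding F_def by (intro J_sum J_mult_left[of "_ / _" 0] J_gbinomial J_divide_nat J_power J_minus J_one) auto

end

theorem theorem6p2:
  fixes p :: nat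
  assumes "prime p" and "p > 3"
  shows "rat_cong p 2
    (\<Sum>k = 1..p - 1. (- 1) ^ k / of_nat k * ((- 1 / 4 :: rat) gchoose k))
    (3 * fermat_quotient p 2 - 3 / 2 * of_nat p * fermat_quotient p 2 ^ 2
      - (2 - of_int (Legendre (- 1) (int p))) * of_nat p * of_int (euler_number (p - 3)))"
proof -
  interpret large_prime p using assms by unfold_locales
  have Q: "J 0 (3 / 2 * of_nat p * fermat_quotient p 2 ^ 2)"
    using J_divide_2[of 0 "3 * of_nat p * fermat_quotient p 2 ^ 2"]
      J_mult_left[of "3 * of_nat p" 0 "fermat_quotient p 2 ^ 2"] J_mult_left[of 3 0 "of_nat p"] by auto
  \<comment> \<open>\<open>rat_cong\<close> also demands that both sides have denominators prime to
    \<open>p\<close>.\<close>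
  have "J 0 (F (- 1 / 4))"
    by (intro J_F J_divide_4 J_minus J_one)
  moreover have "J 0 (3 * fermat_quotient p 2 - 3 / 2 * of_nat p * fermat_quotient p 2 ^ 2
      - (2 - chi) * of_nat p * of_int (euler_number (p - 3)))"
    by (intro J_diff[of 0] Q J_mult_left[of "_ * _" 0] J_mult_left[of "2 - chi" 0] J_mult_left[of 3 0]
        J_numeral J_chi J_fermat_quotient J_of_nat J_of_int)
  ultimately show ?thesis
    using F_minus_quarter_cong unfolding rat_cong_iff Legendre_minus_1 F_def by simp
qed

end
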